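(* Let $a<b$ be real numbers and let $M=(M_n)_{n\in\mathbb{N}}$ be a sequence of positive real numbers with $M_0=1$ and $\liminf_{n\to\infty}\sqrt[n]{M_n}=\infty$, which is logarithmically convex, i.e. $M_n^2\le M_{n-1}M_{n+1}$ for all $n\ge1$, and satisfies one of the following (equivalent) conditions: (i) $\sum_{n\ge1}\frac{1}{\beta_n}=\infty$, where $\beta_n=\inf_{k\ge n}\sqrt[k]{M_k}$; (ii) $\sum_{n\ge1}\frac{1}{\sqrt[n]{M_n}}=\infty$; (iii) $\sum_{n\ge1}\frac{M_{n-1}}{M_n}=\infty$. Let $f\in C^\infty([a,b])$ be real-valued and satisfy $$\sup_{t\in[a,b]}|f^{(n)}(t)|\le M_n\quad\text{for all } n\in\mathbb{N}.$$ If $f^{(n)}(a)>0$ for all $n\in\mathbb{N}$, then $f^{(n)}(x)>0$ for all $n\in\mathbb{N}$ and all $x\in[a,b]$.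
   Context: $\mathbb{N}=\{0,1,2,\dots\}$; $C^\infty([a,b])$ denotes the infinitely differentiable real-valued functions on $[a,b]$, with one-sided derivatives at the endpoints. *)

theory Defs
  imports "HOL-Analysis.Analysis"
begin

text \<open>
  Derivatives are taken relative to the set \<open>S\<close>. For \<open>S = {a..b}\<close> with \<open>a < b\<close> they are one-sided at
  the endpoints, and at points of \<open>S\<close> they depend only on the restriction of \<open>f\<close> to \<open>S\<close>.
\<close>

definition nth_deriv_on :: "real set \<Rightarrow> nat \<Rightarrow> (real \<Rightarrow> real) \<Rightarrow> real \<Rightarrow> real" where
  "nth_deriv_on S n f = ((\<lambda>g x. vector_derivative g (at x within S)) ^^ n) f"

definition smooth_on :: "real set \<Rightarrow> (real \<Rightarrow> real) \<Rightarrow> bool" where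
  "smooth_on S f \<longleftrightarrow> (\<forall>n. nth_deriv_on S n f differentiable_on S)"

text \<open>Used for \<open>n \<ge> 1\<close> only, since \<open>root 0 x = 0\<close> by convention.\<close>

definition beta :: "(nat \<Rightarrow> real) \<Rightarrow> nat \<Rightarrow> real" where
  "beta M n = (INF k\<in>{n..}. root k (M k))"

end

theory Submission
  imports Defs
begin

text \<open>
  Bang's argument. If some \<open>f\<^sup>(\<^sup>k\<^sup>)\<close> were not positive on \<open>[a, b]\<close>, then the mean and intermediate
  value theorems, applied repeatedly, would give zeros \<open>x\<^sub>i\<close> of \<open>f\<^sup>(\<^sup>k\<^sup>+\<^sup>i\<^sup>)\<close> with \<open>x\<^sub>0 \<ge> x\<^sub>1 \<ge> \<dots> \<ge> a\<close>. Say that a point \<open>t\<close> has level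
  \<open>s\<close> if \<open>\<bar>f\<^sup>(\<^sup>k\<^sup>+\<^sup>i\<^sup>)(t)\<bar> \<le> exp (i - s) M\<^sub>k\<^sub>+\<^sub>i\<close> for all \<open>i\<close> with \<open>x\<^sub>i \<le> t\<close>. The point \<open>a\<close> has every level,
  and a point at level \<open>N + 1\<close> has to move right by \<open>M\<^sub>k\<^sub>+\<^sub>N / (exp 1 * M\<^sub>k\<^sub>+\<^sub>N\<^sub>+\<^sub>1)\<close> to fall to level \<open>N\<close>.
  As these distances have infinite sum, \<open>x\<^sub>0\<close> has every level, so all derivatives of \<open>f\<^sup>(\<^sup>k\<^sup>)\<close> vanish
  at \<open>x\<^sub>0\<close>. The same argument run backwards from \<open>x\<^sub>0\<close> makes them vanish at \<open>a\<close>, a contradiction.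
\<close>

section \<open>Propagation of smallness from zeros of the derivatives\<close>

lemma abs_le_by_derivative:
  fixes g \<phi> :: "real \<Rightarrow> real"
  assumes "s \<le> t" "\<bar>g s\<bar> \<le> \<phi> s"
    and g: "\<And>u. u \<in> {s..t} \<Longrightarrow> (g has_real_derivative g' u) (at u within {s..t})"
    and \<phi>: "\<And>u. u \<in> {s..t} \<Longrightarrow> (\<phi> has_real_derivative \<phi>' u) (at u within {s..t})"
    and le: "\<And>u. u \<in> {s..t} \<Longrightarrow> \<bar>g' u\<bar> \<le> \<phi>' u"
  shows "\<bar>g t\<bar> \<le> \<phi> t"
proof (cases "s = t")
  case False
  with \<open>s \<le> t\<close> have "s < t" by simp
  have "norm (g t - g s) \<le> \<phi> t - \<phi> s"
  proof (rule differentiable_bound_general)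
    show "continuous_on {s..t} g" "continuous_on {s..t} \<phi>"
      using g \<phi> by (meson DERIV_continuous_on)+
    fix u assume u: "s < u" "u < t"
    then have "at u within {s..t} = at u"
      by (simp add: at_within_Icc_at)
    then show "(g has_vector_derivative g' u) (at u)" "(\<phi> has_vector_derivative \<phi>' u) (at u)"
      using g[of u] \<phi>[of u] u
      by (auto simp: has_real_derivative_iff_has_vector_derivative)
    show "norm (g' u) \<le> \<phi>' u"
      using le[of u] u by simp
  qed fact
  with \<open>\<bar>g s\<bar> \<le> \<phi> s\<close> show ?thesis by simp
qed (use assms in auto)

text \<open>Downward induction on \<open>i\<close>. Integrating the bound for
  \<open>F (Suc i)\<close> costs a factor \<open>exp 1\<close> from the shift of \<open>i\<close>
  and \<open>M (Suc i) / M i\<close>, which is at most \<open>M (Suc N) / M N\<close> for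
  \<open>i \<le> N\<close>. The growth rate in the exponent is the product of these, so the
  comparison function satisfies \<phi>' = c \<phi>.\<close>

lemma bang_step:
  fixes F :: "nat \<Rightarrow> real \<Rightarrow> real"
  assumes deriv: "\<And>i t. t \<in> {a..b} \<Longrightarrow> (F i has_real_derivative F (Suc i) t) (at t within {a..b})"
    and bound: "\<And>i t. t \<in> {a..b} \<Longrightarrow> \<bar>F i t\<bar> \<le> M i"
    and pos: "\<And>i. M i > 0"
    and ratio: "\<And>i j. i \<le> j \<Longrightarrow> M (Suc i) / M i \<le> M (Suc j) / M j"
    and X: "decseq X" "\<And>i. X i \<in> {a..b}" "\<And>i. F i (X i) = 0"
    and y: "y \<in> {a..b}" "\<And>i. X i \<le> y \<Longrightarrow> \<bar>F i y\<bar> \<le> exp (real i - real (Suc N)) * M i"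
    and "X i \<le> t" "y \<le> t" "t \<le> b"
  shows "\<bar>F i t\<bar> \<le> exp (real i - real (Suc N) + exp 1 * (M (Suc N) / M N) * (t - y)) * M i"
  using \<open>X i \<le> t\<close> \<open>y \<le> t\<close> \<open>t \<le> b\<close>
proof (induction "Suc N - i" arbitrary: i t)
  \<comment> \<open>Truncated subtraction makes this the case \<open>i > N\<close>: the exponent is
    nonnegative, so the global bound \<open>M i\<close> suffices.\<close>
  case 0
  define c where "c = exp 1 * (M (Suc N) / M N)"
  have "c > 0" using pos by (simp add: c_def)
  then have "0 \<le> real i - real (Suc N) + c * (t - y)"
    using 0 by simp
  then have "1 * M i \<le> exp (real i - real (Suc N) + c * (t - y)) * M i"
    using pos[of i] by (intro mult_right_mono) auto
  then show ?case
    using bound[of t i] 0 y by (simp add: c_def)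
next
  case (Suc n)
  define c where "c = exp 1 * (M (Suc N) / M N)"
  define \<phi> where "\<phi> u = exp (real i - real (Suc N) + c * (u - y)) * M i" for u
  \<comment> \<open>The integration starts where a bound is known: at \<open>y\<close> by its level
    if \<open>X i \<le> y\<close>, otherwise at the zero \<open>X i\<close>.\<close>
  define s where "s = max y (X i)"
  have "i \<le> N" using Suc.hyps(2) by simp
  have "{s..t} \<subseteq> {a..b}" using Suc.prems y X(2)[of i] by (auto simp: s_def)
  have "\<bar>F i t\<bar> \<le> \<phi> t"
  proof (rule abs_le_by_derivative[where s = s and t = t and g = "F i" and \<phi> = \<phi>])
    show "s \<le> t" using Suc.prems by (simp add: s_def)
    show "\<bar>F i s\<bar> \<le> \<phi> s"
    proof (cases "X i \<le> y")
      case True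
      then show ?thesis using y(2) by (simp add: s_def \<phi>_def max_absorb1)
    next
      case False
      then show ?thesis using X(3)[of i] pos[of i] by (simp add: s_def \<phi>_def)
    qed
    fix u assume u: "u \<in> {s..t}"
    show "(F i has_real_derivative F (Suc i) u) (at u within {s..t})"
      using deriv[of u i] u \<open>{s..t} \<subseteq> {a..b}\<close> by (auto intro: DERIV_subset)
    show "(\<phi> has_real_derivative c * \<phi> u) (at u within {s..t})"
      unfolding \<phi>_def by (auto intro!: derivative_eq_intros)
    have "X (Suc i) \<le> u"
      using u decseqD[OF X(1), of i "Suc i"] by (simp add: s_def)
    then have "\<bar>F (Suc i) u\<bar> \<le> exp (real (Suc i) - real (Suc N) + c * (u - y)) * M (Suc i)"
      unfolding c_def using Suc.hyps Suc.prems u by (intro Suc.hyps(1)) (auto simp: s_def)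
    also have "\<dots> \<le> exp (real (Suc i) - real (Suc N) + c * (u - y)) * (M (Suc N) / M N * M i)"
      using ratio[OF \<open>i \<le> N\<close>] pos[of i] by (intro mult_left_mono) (auto simp: field_simps)
    also have "real (Suc i) - real (Suc N) + c * (u - y) = 1 + (real i - real (Suc N) + c * (u - y))"
      by simp
    also have "exp \<dots> * (M (Suc N) / M N * M i) = c * \<phi> u"
      unfolding exp_add[of 1] by (simp add: \<phi>_def c_def)
    finally show "\<bar>F (Suc i) u\<bar> \<le> c * \<phi> u" .
  qed
  then show ?case by (simp add: \<phi>_def c_def)
qed

lemma bang_zero:
  fixes F :: "nat \<Rightarrow> real \<Rightarrow> real"
  assumes deriv: "\<And>i t. t \<in> {a..b} \<Longrightarrow> (F i has_real_derivative F (Suc i) t) (at t within {a..b})"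
    and bound: "\<And>i t. t \<in> {a..b} \<Longrightarrow> \<bar>F i t\<bar> \<le> M i"
    and pos: "\<And>i. M i > 0"
    and ratio: "\<And>i j. i \<le> j \<Longrightarrow> M (Suc i) / M i \<le> M (Suc j) / M j"
    and div: "\<not> summable (\<lambda>n. M n / M (Suc n))"
    and X: "decseq X" "\<And>i. X i \<in> {a..b}" "\<And>i. F i (X i) = 0"
    and "X i \<le> t" "t \<le> b"
  shows "F i t = 0"
proof -
  \<comment> \<open>Over the distance \<open>d m\<close> the exponent in \<open>bang_step\<close>
    with \<open>N = m\<close> grows by exactly 1, which lowers the level from \<open>m + 1\<close>
    to \<open>m\<close>.\<close>
  define d where "d n = M n / M (Suc n) / exp 1" for n
  have d_pos: "d n > 0" for n using pos by (simp add: d_def)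
  have level: "\<bar>F i z\<bar> \<le> exp (real i - real m) * M i"
    if "z \<in> {a..b}" "z - a \<le> (\<Sum>j=m..<m+k. d j)" "X i \<le> z" for z m k i
    using that
  proof (induction k arbitrary: m z i)
    case 0
    then have "X i = z" using X(2)[of i] by simp
    then show ?case using X(3)[of i] pos[of i] by simp
  next
    case (Suc k)
    define S where "S = (\<Sum>j=Suc m..<Suc m+k. d j)"
    \<comment> \<open>The rightmost point up to \<open>z\<close> to which the induction hypothesis
      gives level \<open>m + 1\<close>; at most \<open>d m\<close> remains to
      \<open>z\<close>.\<close>
    define y where "y = min z (a + S)"
    define r where "r = M (Suc m) / M m"
    have "S \<ge> 0" unfolding S_def using d_pos by (intro sum_nonneg) (simp add: less_imp_le)
    then have y: "y \<in> {a..b}" "y \<le> z" "y - a \<le> S" using Suc.prems by (auto simp: y_def)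
    have "\<bar>F i z\<bar> \<le> exp (real i - real (Suc m) + exp 1 * (M (Suc m) / M m) * (z - y)) * M i"
      using Suc.prems y
      by (intro bang_step[OF deriv bound pos ratio X y(1)] Suc.IH) (auto simp: S_def)
    also have "exp 1 * (M (Suc m) / M m) * (z - y) \<le> exp 1 * (M (Suc m) / M m) * d m"
    proof (rule mult_left_mono)
      have "(\<Sum>j=m..<m+Suc k. d j) = d m + S"
        using sum.atLeast_Suc_lessThan[of m "m + Suc k" d] by (simp add: S_def del: sum.op_ivl_Suc)
      then show "z - y \<le> d m"
        using Suc.prems d_pos[of m] by (auto simp: y_def min_def)
    qed (use pos[of m] pos[of "Suc m"] in simp)
    also have "exp 1 * (M (Suc m) / M m) * d m = 1"
      using pos[of m] pos[of "Suc m"] by (simp add: d_def field_simps)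
    finally show ?case using pos[of i] by simp
  qed
  have "\<exists>k. L \<le> (\<Sum>j=m..<m+k. d j)" for m L
  proof (rule ccontr)
    assume *: "\<nexists>k. L \<le> (\<Sum>j=m..<m+k. d j)"
    have "summable (\<lambda>j. d (j + m))"
    proof (rule summableI_nonneg_bounded)
      fix k
      have "(\<Sum>j<k. d (j + m)) = (\<Sum>j=m..<m+k. d j)"
        using sum.shift_bounds_nat_ivl[of d 0 m k] by (simp add: atLeast0LessThan add.commute)
      with * show "(\<Sum>j<k. d (j + m)) \<le> L" by (metis linorder_le_cases)
    qed (use d_pos in \<open>simp add: less_imp_le\<close>)
    then have "summable d" by simp
    then have "summable (\<lambda>n. d n * exp 1)" by (rule summable_mult2)
    with div show False by (simp add: d_def)
  qed
  moreover have "t \<in> {a..b}" using X(2)[of i] \<open>X i \<le> t\<close> \<open>t \<le> b\<close> by simp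
  ultimately have le: "\<bar>F i t\<bar> \<le> exp (real i - real m) * M i" for m
    using level \<open>X i \<le> t\<close> by meson
  have "(\<lambda>m. exp (real i) * inverse (exp (real m)) * M i) \<longlonglongrightarrow> exp (real i) * 0 * M i"
    by (intro tendsto_intros tendsto_inverse_0_at_top
        filterlim_compose[OF exp_at_top filterlim_real_sequentially])
  then have "(\<lambda>m. exp (real i - real m) * M i) \<longlonglongrightarrow> 0"
    by (simp add: exp_diff divide_inverse)
  then have "\<bar>F i t\<bar> \<le> 0"
    by (rule LIMSEQ_le_const) (use le in auto)
  then show ?thesis by simp
qed

lemma quasianalytic_pos:
  fixes F :: "nat \<Rightarrow> real \<Rightarrow> real"
  assumes deriv: "\<And>i t. t \<in> {a..b} \<Longrightarrow> (F i has_real_derivative F (Suc i) t) (at t within {a..b})"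
    and bound: "\<And>i t. t \<in> {a..b} \<Longrightarrow> \<bar>F i t\<bar> \<le> M i"
    and pos: "\<And>i. M i > 0"
    and ratio: "\<And>i j. i \<le> j \<Longrightarrow> M (Suc i) / M i \<le> M (Suc j) / M j"
    and div: "\<not> summable (\<lambda>n. M n / M (Suc n))"
    and start: "\<And>i. F i a > 0"
    and x: "x \<in> {a..b}"
  shows "F 0 x > 0"
proof (rule ccontr)
  assume "\<not> F 0 x > 0"
  have cont: "continuous_on {a..b} (F i)" for i
    using deriv by (meson DERIV_continuous_on)
  have zero: "\<exists>z\<in>{a..t}. F i z = 0" if "t \<in> {a..b}" "F i t \<le> 0" for i t
    using IVT2'[of "F i" t 0 a] that start[of i] continuous_on_subset[OF cont, of "{a..t}" i]
    by auto
  have "\<exists>X. \<forall>i. (X i \<in> {a..b} \<and> F i (X i) = 0) \<and> X (Suc i) \<le> X i"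
  proof (rule dependent_nat_choice)
    show "\<exists>z. z \<in> {a..b} \<and> F 0 z = 0"
      using zero[OF x, of 0] x \<open>\<not> F 0 x > 0\<close> by force
    fix y i assume y: "y \<in> {a..b} \<and> F i y = 0"
    then have "a < y" using start[of i] by (cases "a = y") auto
    then have "\<exists>u\<in>{a<..<y}. F i y - F i a = F (Suc i) u * (y - a)"
    proof (rule mvt_simple[where f' = "\<lambda>u. (*) (F (Suc i) u)"])
      fix u assume "a \<le> u" "u \<le> y"
      then show "(F i has_derivative (*) (F (Suc i) u)) (at u within {a..y})"
        using has_derivative_subset[OF deriv[of u i, unfolded has_field_derivative_def], of "{a..y}"] y
        by simp
    qed
    then obtain u where u: "a < u" "u < y" "F i y - F i a = F (Suc i) u * (y - a)"
      by auto
    \<comment> \<open>\<open>F i\<close> falls from a positive value at \<open>a\<close> to 0 at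
      \<open>y\<close>, so its mean slope is negative.\<close>
    have "F (Suc i) u * (y - a) < 0"
      using u(3) y start[of i] by simp
    then have "F (Suc i) u \<le> 0"
      using \<open>a < y\<close> by (simp add: mult_less_0_iff)
    moreover have "u \<in> {a..b}" using u y by simp
    ultimately obtain z where "z \<in> {a..u}" "F (Suc i) z = 0"
      using zero by blast
    then show "\<exists>z. (z \<in> {a..b} \<and> F (Suc i) z = 0) \<and> z \<le> y"
      using u y by (intro exI[of _ z]) simp
  qed
  then obtain X where X: "\<And>i. X i \<in> {a..b}" "\<And>i. F i (X i) = 0" "decseq X"
    by (auto simp: decseq_Suc_iff)
  define c where "c = X 0"
  have c: "c \<in> {a..b}" using X(1) by (simp add: c_def)
  have Fc: "F i c = 0" for i
  proof (rule bang_zero[OF deriv bound pos ratio div X(3,1,2)])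
    show "X i \<le> c" "c \<le> b" using decseqD[OF X(3), of 0 i] c by (auto simp: c_def)
  qed
  \<comment> \<open>Reflection turns the way from \<open>c\<close> back to \<open>a\<close> into a
    way to the right; the sign keeps \<open>G (Suc i)\<close> the derivative of \<open>G i\<close>.
    As every \<open>F i\<close> vanishes at \<open>c\<close>, the constant sequence
    \<open>- c\<close> serves as the zeros.\<close>
  define G where "G i t = (-1) ^ i * F i (- t)" for i t
  have "G 0 (- a) = 0"
  proof (rule bang_zero[of "- c" "- a" G M "\<lambda>_. - c"])
    fix i t assume t: "t \<in> {- c..- a}"
    have "(F i has_real_derivative F (Suc i) (- t)) (at (- t) within uminus ` {- c..- a})"
      by (rule DERIV_subset[OF deriv]) (use t c in auto)
    then have "((\<lambda>t. F i (- t)) has_real_derivative - F (Suc i) (- t)) (at t within {- c..- a})"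
      using DERIV_image_chain[of "F i" _ uminus t "{- c..- a}" "- 1"]
      by (simp add: o_def DERIV_minus[OF DERIV_ident])
    then have "(G i has_real_derivative (-1) ^ i * (- F (Suc i) (- t))) (at t within {- c..- a})"
      unfolding G_def by (rule DERIV_cmult)
    then show "(G i has_real_derivative G (Suc i) t) (at t within {- c..- a})"
      by (simp add: G_def)
    show "\<bar>G i t\<bar> \<le> M i"
      using bound[of "- t" i] t c by (simp add: G_def abs_mult)
  qed (use pos ratio div c Fc in \<open>auto simp: G_def\<close>)
  with start[of 0] show False by (simp add: G_def)
qed

section \<open>Log-convex weights and the three divergence conditions\<close>

lemma mono_ratio_of_log_convex:
  fixes M :: "nat \<Rightarrow> real"
  assumes pos: "\<And>n. M n > 0" and conv: "\<And>n. (M (Suc n))\<^sup>2 \<le> M n * M (Suc (Suc n))"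
  shows "mono (\<lambda>n. M (Suc n) / M n)"
proof (rule mono_iff_le_Suc[THEN iffD2], rule allI)
  fix n
  show "M (Suc n) / M n \<le> M (Suc (Suc n)) / M (Suc n)"
    using conv[of n] pos by (simp add: field_simps power2_eq_square)
qed

text \<open>\<open>M n\<close> is the product of the first \<open>n\<close> ratios, each at most
  \<open>r n\<close>. Hence \<open>M n ^ Suc n \<le> (r n * M n) ^ n = M (Suc n) ^ n\<close>, and a
  root of order \<open>n * Suc n\<close> is taken.\<close>

lemma mono_root_of_log_convex:
  fixes M :: "nat \<Rightarrow> real"
  assumes pos: "\<And>n. M n > 0" and "M 0 = 1" and ratio: "mono (\<lambda>n. M (Suc n) / M n)"
  shows "mono (\<lambda>n. root (Suc n) (M (Suc n)))"
proof (rule mono_iff_le_Suc[THEN iffD2], rule allI)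
  fix m
  define r where "r n = M (Suc n) / M n" for n
  have M_Suc: "M (Suc n) = r n * M n" for n
    using pos[of n] by (simp add: r_def)
  have r_pos: "r n > 0" for n using pos by (simp add: r_def)
  have M_le: "M n \<le> r n ^ n" for n
  proof (induction n)
    case (Suc n)
    have "M (Suc n) \<le> r n * r n ^ n"
      unfolding M_Suc using Suc r_pos[of n] by (intro mult_left_mono) auto
    also have "\<dots> \<le> r (Suc n) ^ Suc n"
      using monoD[OF ratio, of n "Suc n"] r_pos[of n] power_mono[of "r n" "r (Suc n)" "Suc n"]
      by (auto simp: r_def)
    finally show ?case .
  qed (simp add: \<open>M 0 = 1\<close>)
  define n where "n = Suc m"
  then have "n > 0" by simp
  have "M n ^ Suc n \<le> M (Suc n) ^ n"
    unfolding M_Suc[of n] power_mult_distrib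
    using mult_right_mono[OF M_le[of n], of "M n ^ n"] pos[of n] by simp
  then have "root (n * Suc n) (M n ^ Suc n) \<le> root (n * Suc n) (M (Suc n) ^ n)"
    by (intro real_root_le_mono) (auto simp: n_def)
  also have "root (n * Suc n) (M n ^ Suc n) = root n (M n)"
    unfolding real_root_mult_exp using pos[of n]
    by (simp add: real_root_power_cancel less_imp_le del: power_Suc)
  also have "root (n * Suc n) (M (Suc n) ^ n) = root (Suc n) (M (Suc n))"
    unfolding mult.commute[of n] real_root_mult_exp
    using pos[of "Suc n"] \<open>n > 0\<close> by (simp add: real_root_power_cancel less_imp_le)
  finally show "root (Suc m) (M (Suc m)) \<le> root (Suc (Suc m)) (M (Suc (Suc m)))"
    by (simp add: n_def)
qed

text \<open>Identifies the series of (i) with that of (ii): increasing roots attain their infimum at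
  the first index.\<close>

lemma beta_eq_root:
  assumes "mono (\<lambda>n. root (Suc n) (M (Suc n)))"
  shows "beta M (Suc n) = root (Suc n) (M (Suc n))"
  unfolding beta_def
proof (rule cInf_eq_minimum)
  fix x assume "x \<in> (\<lambda>k. root k (M k)) ` {Suc n..}"
  then obtain j where "x = root j (M j)" "Suc n \<le> j" by auto
  then obtain k where "x = root (Suc k) (M (Suc k))" "n \<le> k" by (cases j) auto
  then show "root (Suc n) (M (Suc n)) \<le> x"
    using monoD[OF assms, of n k] by simp
qed auto

text \<open>
  Carleman's inequality for the decreasing sequence \<open>M\<^sub>n / M\<^sub>n\<^sub>+\<^sub>1\<close>, up to the constant. Monotonicity allows a
  direct proof: with \<open>u\<^sub>n\<close> the inverse roots, \<open>u\<^sub>2\<^sub>n \<le> sqrt (u\<^sub>n M\<^sub>n / M\<^sub>n\<^sub>+\<^sub>1) \<le> u\<^sub>n / 4 + M\<^sub>n / M\<^sub>n\<^sub>+\<^sub>1\<close>, so the sum of the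
  \<open>u\<^sub>n\<close> over \<open>n \<le> 2 K\<close> is controlled by half of itself.
\<close>

lemma summable_inverse_root:
  fixes M :: "nat \<Rightarrow> real"
  assumes pos: "\<And>n. M n > 0" and "M 0 = 1" and ratio: "mono (\<lambda>n. M (Suc n) / M n)"
    and sum: "summable (\<lambda>n. M n / M (Suc n))"
  shows "summable (\<lambda>n. 1 / root (Suc n) (M (Suc n)))"
proof -
  define u where "u n = 1 / root n (M n)" for n
  define q where "q n = M n / M (Suc n)" for n
  have u_pos: "u n > 0" if "n > 0" for n using that pos by (simp add: u_def)
  have q_pos: "q n > 0" for n using pos by (simp add: q_def)
  have u_dec: "u (Suc n) \<le> u n" if "n > 0" for n
    using monoD[OF mono_root_of_log_convex[OF pos \<open>M 0 = 1\<close> ratio], of "n - 1" n] that pos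
    by (auto simp: u_def intro!: divide_left_mono)
  \<comment> \<open>\<open>M n / M (n + k)\<close> is a product of \<open>k\<close> values of the
    decreasing sequence \<open>q\<close>, the largest being \<open>q n\<close>.\<close>
  have M_add: "M n \<le> q n ^ k * M (n + k)" for n k
  proof (induction k)
    case (Suc k)
    have "q (n + k) \<le> q n"
      using monoD[OF ratio, of n "n + k"] pos[of n] pos[of "Suc n"] pos[of "n + k"] pos[of "Suc (n + k)"]
      by (simp add: q_def field_simps)
    have "M n \<le> q n ^ k * (q (n + k) * M (Suc (n + k)))"
      using Suc pos[of "Suc (n + k)"] by (simp add: q_def)
    also have "\<dots> \<le> q n ^ k * (q n * M (Suc (n + k)))"
      using \<open>q (n + k) \<le> q n\<close> pos[of "Suc (n + k)"] q_pos[of n]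
      by (intro mult_left_mono mult_right_mono) (auto simp: less_imp_le)
    finally show ?case by (simp add: mult_ac)
  qed simp
  have u_double: "u (2 * n) \<le> u n / 4 + q n" if "n > 0" for n
  proof -
    have "1 / M (2 * n) \<le> q n ^ n * (1 / M n)"
      using M_add[of n n, folded mult_2] pos[of n] pos[of "2 * n"] by (simp add: field_simps)
    then have "root n (1 / M (2 * n)) \<le> root n (q n ^ n * (1 / M n))"
      using that by (intro real_root_le_mono)
    also have "\<dots> = q n * u n"
      using that q_pos[of n]
      by (simp add: real_root_mult u_def real_root_divide real_root_power_cancel less_imp_le)
    finally have "sqrt (root n (1 / M (2 * n))) \<le> sqrt (q n * u n)"
      by (rule real_sqrt_le_mono)
    also have "sqrt (root n (1 / M (2 * n))) = u (2 * n)"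
      using that by (simp add: sqrt_def real_root_mult_exp real_root_divide u_def)
    also have "sqrt (q n * u n) = sqrt (q n * 2 * (u n / 2))" by simp
    also have "\<dots> \<le> (q n * 2 + u n / 2) / 2"
      using q_pos[of n] u_pos[OF that] by (intro arith_geo_mean_sqrt) auto
    finally show ?thesis by simp
  qed
  \<comment> \<open>Solves \<open>S \<le> u 1 + 2 * (S / 4 + suminf q)\<close> for the partial sum
    \<open>S\<close>.\<close>
  define B where "B = 2 * u 1 + 4 * suminf q"
  have "(\<Sum>n<K. u (Suc n)) \<le> B" for K
  proof -
    \<comment> \<open>Each odd-indexed term after \<open>u 1\<close> is bounded by its even-indexed
      predecessor.\<close>
    have double: "(\<Sum>n<Suc (2 * K). u (Suc n)) \<le> u 1 + 2 * (\<Sum>n<K. u (2 * Suc n))"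
    proof (induction K)
      case (Suc K)
      then show ?case using u_dec[of "Suc (Suc (2 * K))"] by simp
    qed simp
    have "(\<Sum>n<K. u (2 * Suc n)) \<le> (\<Sum>n<K. u (Suc n) / 4 + q (Suc n))"
      by (intro sum_mono u_double) simp
    also have "\<dots> = (\<Sum>n<K. u (Suc n)) / 4 + (\<Sum>n<K. q (Suc n))"
      by (simp add: sum.distrib sum_divide_distrib)
    also have "(\<Sum>n<K. q (Suc n)) \<le> (\<Sum>n<Suc K. q n)"
      unfolding sum.lessThan_Suc_shift using q_pos[of 0] by simp
    also have "\<dots> \<le> suminf q"
      using sum q_pos by (intro sum_le_suminf) (auto simp: q_def[abs_def] less_imp_le)
    finally have half: "(\<Sum>n<K. u (2 * Suc n)) \<le> (\<Sum>n<K. u (Suc n)) / 4 + suminf q"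
      by simp
    have "(\<Sum>n<K. u (Suc n)) \<le> (\<Sum>n<Suc (2 * K). u (Suc n))"
      using u_pos by (intro sum_mono2) (auto simp: less_imp_le)
    with double half show ?thesis unfolding B_def by linarith
  qed
  then have "summable (\<lambda>n. u (Suc n))"
    using u_pos by (intro summableI_nonneg_bounded) (auto simp: less_imp_le)
  then show ?thesis by (simp add: u_def)
qed

section \<open>Application to the derivatives of \<open>f\<close>\<close>

theorem corollary4p5:
  fixes a b :: real and M :: "nat \<Rightarrow> real" and f :: "real \<Rightarrow> real"
  assumes "a < b"
    and "\<And>n. M n > 0"
    and "M 0 = 1"
    and "liminf (\<lambda>n. ereal (root n (M n))) = \<infinity>"
    and "\<And>n. n \<ge> 1 \<Longrightarrow> (M n)\<^sup>2 \<le> M (n - 1) * M (n + 1)"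
    and "\<not> summable (\<lambda>n. 1 / beta M (Suc n)) \<or>
         \<not> summable (\<lambda>n. 1 / root (Suc n) (M (Suc n))) \<or>
         \<not> summable (\<lambda>n. M n / M (Suc n))"
    and "smooth_on {a..b} f"
    and "\<And>n. (SUP t\<in>{a..b}. \<bar>nth_deriv_on {a..b} n f t\<bar>) \<le> M n"
    and "\<And>n. nth_deriv_on {a..b} n f a > 0"
  shows "\<forall>n. \<forall>x\<in>{a..b}. nth_deriv_on {a..b} n f x > 0"
proof (intro allI ballI)
  fix k x assume x: "x \<in> {a..b}"
  define F where "F n = nth_deriv_on {a..b} n f" for n
  have deriv: "(F n has_real_derivative F (Suc n) t) (at t within {a..b})" if "t \<in> {a..b}" for n t
  proof -
    have "F n differentiable (at t within {a..b})"
      using assms(7) that by (simp add: smooth_on_def differentiable_on_def F_def)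
    then have "(F n has_vector_derivative vector_derivative (F n) (at t within {a..b})) (at t within {a..b})"
      by (simp add: vector_derivative_works)
    then show ?thesis
      by (simp add: F_def nth_deriv_on_def has_real_derivative_iff_has_vector_derivative)
  qed
  have bound: "\<bar>F n t\<bar> \<le> M n" if "t \<in> {a..b}" for n t
  proof -
    \<comment> \<open>A real \<open>SUP\<close> bounds the values only if they are bounded above,
      which continuity on a compact interval provides.\<close>
    have "continuous_on {a..b} (\<lambda>t. \<bar>F n t\<bar>)"
      using deriv by (intro continuous_intros) (meson DERIV_continuous_on)
    then have "bdd_above ((\<lambda>t. \<bar>F n t\<bar>) ` {a..b})"
      by (intro bounded_imp_bdd_above compact_imp_bounded compact_continuous_image) auto
    then have "\<bar>F n t\<bar> \<le> (SUP t\<in>{a..b}. \<bar>F n t\<bar>)"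
      using that by (rule cSUP_upper2) simp
    with assms(8)[of n] show ?thesis by (simp add: F_def)
  qed
  have ratio: "mono (\<lambda>n. M (Suc n) / M n)"
    using mono_ratio_of_log_convex[of M] assms(2) assms(5)[of "Suc _"] by simp
  have "\<not> summable (\<lambda>n. M n / M (Suc n))"
    using assms(6) summable_inverse_root[OF assms(2,3) ratio]
    unfolding beta_eq_root[OF mono_root_of_log_convex[OF assms(2,3) ratio]] by blast
  \<comment> \<open>Shifting functions and weights by \<open>k\<close> reduces the claim to order
    zero; the tail still diverges.\<close>
  then have "\<not> summable (\<lambda>n. M (n + k) / M (Suc (n + k)))"
    using summable_iff_shift[of "\<lambda>n. M n / M (Suc n)" k] by simp
  then have "F (0 + k) x > 0"
    using x deriv bound assms(2,9) monoD[OF ratio]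
    by (intro quasianalytic_pos[of a b "\<lambda>i. F (i + k)" "\<lambda>i. M (i + k)"]) (auto simp: F_def)
  then show "nth_deriv_on {a..b} k f x > 0" by (simp add: F_def)
qed

end
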